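(* Let $\mathbb F_q$ be a field with $q$ elements and let $0\le b_i\le a_i\le q-2$ be integers for $i=1,2$. Then there is an asymmetric quantum code $Q_{a_1,a_2,b_1,b_2}$ with parameters $$[[(q-1)^2,\ k_1+k_2-(q-1)^2,\ d_z/d_x]]_q,$$ where $$k_i=\frac{(q-1)(a_i+b_i+1)+\gcd(a_i-b_i,q-2)+1}{2},\quad i=1,2,$$ $$d_z\ge q-1-a_1,\qquad d_x\ge q-1-a_2 .$$
   Context: Let $p$ be the characteristic of $\mathbb F_q$, $\omega=\exp(2\pi i/p)$, and $\mathrm{tr}:\mathbb F_q\to\mathbb F_p$ the trace. Let $|x\rangle$, $x\in\mathbb F_q$, be an orthonormal basis of $\mathbb C^q$, and for $\alpha,\beta\in\mathbb F_q$ define unitary operators on $\mathbb C^q$ by $X(\alpha)|x\rangle=|x+\alpha\rangle$ and $Z(\beta)|x\rangle=\omega^{\mathrm{tr}(\beta x)}|x\rangle$. On $\mathbb C^{q^n}=(\mathbb C^q)^{\otimes n}$ put $X(\mathbf u)=X(u_1)\otimes\dots\otimes X(u_n)$ and $Z(\mathbf v)=Z(v_1)\otimes\dots\otimes Z(v_n)$ for $\mathbf u,\mathbf v\in\mathbb F_q^n$. The operators $\omega^cX(\mathbf u)$, $c\in\mathbb F_p$, represent the qubit-flip errors (also called bit-flip errors) and the operators $\omega^cZ(\mathbf v)$, $c\in\mathbb F_p$, represent the phase-shift errors (also called phase-flip errors); the number of errors is the number of non-zero coordinates of $\mathbf u$, respectively $\mathbf v$. A $q$-ary asymmetric quantum code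 with parameters $[[n,k,d_z/d_x]]_q$ is a $q^k$-dimensional subspace of the Hilbert space $\mathbb C^{q^n}$ that can control (correct) all qubit-flip errors up to $\lfloor\frac{d_x-1}{2}\rfloor$ and all phase-shift errors up to $\lfloor\frac{d_z-1}{2}\rfloor$, and that detects $d_x-1$ qubit-flip errors as well as $d_z-1$ phase-shift errors. The symbol $Q_{a_1,a_2,b_1,b_2}$ is just a name for the code whose existence is asserted.
   Formalization: The formal theorem adds the hypothesis k_1+k_2 ≥ (q-1)^2; without it the claim fails, e.g. for q=4 and all a_i=b_i=0 one gets k_1+k_2-(q-1)^2=-3, and no subspace has dimension q^{-3}. *)

theory Defs
  imports "HOL-Analysis.Analysis" "HOL-Computational_Algebra.Primes"
begin

section \<open>The trace to the prime field\<close>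

definition prime_degree :: "'a::finite_field itself \<Rightarrow> nat" where
  "prime_degree _ = (THE m. CARD('a) = CHAR('a) ^ m)"

definition field_tr :: "'a::finite_field \<Rightarrow> 'a" where
  "field_tr x = (\<Sum>i<prime_degree TYPE('a). x ^ (CHAR('a) ^ i))"

text \<open>The trace lies in the prime field, which is identified with the residues \<open>0, \<dots>, p - 1\<close>;
  this representative is what serves as an exponent of a \<open>p\<close>-th root of unity.\<close>

definition tr :: "'a::finite_field \<Rightarrow> nat" where
  "tr x = (THE c. c < CHAR('a) \<and> of_nat c = field_tr x)"

definition \<omega> :: "'a::finite_field itself \<Rightarrow> complex" where
  "\<omega> _ = exp (2 * of_real pi * \<i> / of_nat CHAR('a))"


section \<open>Operators on the state space\<close>

text \<open>The space \<open>\<complex>\<^sup>q\<close> is \<^typ>\<open>complex ^ 'a\<close>, with basis vectors \<open>|x\<rangle> = axis x 1\<close>. Its \<open>n\<close>-fold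
  tensor power is \<^typ>\<open>complex ^ ('a ^ 'n)\<close>: the product basis vector
  \<open>|x\<^sub>1\<rangle> \<otimes> \<dots> \<otimes> |x\<^sub>n\<rangle>\<close> is \<open>axis x 1\<close> with \<open>x = (x\<^sub>1, \<dots>, x\<^sub>n)\<close>. Operators are matrices, whose
  column \<open>y\<close> is the image of \<open>|y\<rangle>\<close>.\<close>

definition X1 :: "'a::finite_field \<Rightarrow> ((complex, 'a) vec, 'a) vec" where
  "X1 \<alpha> = (\<chi> x y. if x = y + \<alpha> then 1 else 0)"

definition Z1 :: "'a::finite_field \<Rightarrow> ((complex, 'a) vec, 'a) vec" where
  "Z1 \<beta> = (\<chi> x y. if x = y then \<omega> TYPE('a) ^ tr (\<beta> * y) else 0)"

definition tensor :: "('n \<Rightarrow> complex ^ 'a ^ 'a) \<Rightarrow> complex ^ ('a::finite ^ 'n::finite) ^ ('a ^ 'n)" where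
  "tensor A = (\<chi> x y. \<Prod>i\<in>UNIV. A i $ (x $ i) $ (y $ i))"

definition Xop :: "'a::finite_field ^ 'n::finite \<Rightarrow> complex ^ ('a ^ 'n) ^ ('a ^ 'n)" where
  "Xop u = tensor (\<lambda>i. X1 (u $ i))"

definition Zop :: "'a::finite_field ^ 'n::finite \<Rightarrow> complex ^ ('a ^ 'n) ^ ('a ^ 'n)" where
  "Zop v = tensor (\<lambda>i. Z1 (v $ i))"

lemma mult_axis_nth: "(A *v axis x 1) $ y = (A $ y $ x :: complex)"
  by (simp add: matrix_vector_mult_def axis_def if_distrib cong: if_cong)

lemma X1_axis: "X1 \<alpha> *v axis x 1 = axis (x + \<alpha>) 1"
  by (simp add: vec_eq_iff mult_axis_nth) (simp add: X1_def axis_def)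

lemma Z1_axis: "Z1 (\<beta> :: 'a::finite_field) *v axis x 1 = \<omega> TYPE('a) ^ tr (\<beta> * x) *s axis x 1"
  by (simp add: vec_eq_iff mult_axis_nth) (simp add: Z1_def axis_def)

lemma Xop_axis: "Xop u *v axis x 1 = axis (x + u) 1"
proof -
  have "(\<Prod>i\<in>UNIV. if y $ i = x $ i + u $ i then 1 else 0 :: complex) = (if y = x + u then 1 else 0)"
    for y
    by (auto simp: vec_eq_iff intro!: prod_zero)
  then have "(Xop u *v axis x 1) $ y = axis (x + u) 1 $ y" for y
    unfolding mult_axis_nth by (simp add: Xop_def tensor_def X1_def axis_def)
  then show ?thesis
    unfolding vec_eq_iff by blast
qed

lemma Zop_axis:
  "Zop (v :: 'a::finite_field ^ 'n::finite) *v axis x 1 =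
     (\<Prod>i\<in>UNIV. \<omega> TYPE('a) ^ tr (v $ i * x $ i)) *s axis x 1"
proof -
  have "(\<Prod>i\<in>UNIV. if y $ i = x $ i then \<omega> TYPE('a) ^ tr (v $ i * x $ i) else 0) =
      (if y = x then \<Prod>i\<in>UNIV. \<omega> TYPE('a) ^ tr (v $ i * x $ i) else 0)" for y
    by (auto simp: vec_eq_iff intro!: prod_zero)
  then have "(Zop v *v axis x 1) $ y =
      ((\<Prod>i\<in>UNIV. \<omega> TYPE('a) ^ tr (v $ i * x $ i)) *s axis x 1) $ y" for y
    unfolding mult_axis_nth by (simp add: Zop_def tensor_def Z1_def axis_def)
  then show ?thesis
    unfolding vec_eq_iff by blast
qed


section \<open>Errors\<close>

definition wt :: "'a::zero ^ 'n::finite \<Rightarrow> nat" where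
  "wt u = card {i. u $ i \<noteq> 0}"

definition flip_errors :: "nat \<Rightarrow> (complex ^ ('a::finite_field ^ 'n::finite) ^ ('a ^ 'n)) set" where
  "flip_errors t = {mat (\<omega> TYPE('a) ^ c) ** Xop u | c u. c < CHAR('a) \<and> wt u \<le> t}"

definition phase_errors :: "nat \<Rightarrow> (complex ^ ('a::finite_field ^ 'n::finite) ^ ('a ^ 'n)) set" where
  "phase_errors t = {mat (\<omega> TYPE('a) ^ c) ** Zop v | c v. c < CHAR('a) \<and> wt v \<le> t}"

text \<open>Qubit-flip and phase-shift errors may occur at the same time. Both classes contain the
  identity, so the set below contains \<^term>\<open>flip_errors s\<close> and \<^term>\<open>phase_errors t\<close>.\<close>

definition errors :: "nat \<Rightarrow> nat \<Rightarrow> (complex ^ ('a::finite_field ^ 'n::finite) ^ ('a ^ 'n)) set" where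
  "errors s t = {E ** F | E F. E \<in> flip_errors s \<and> F \<in> phase_errors t}"


section \<open>Correction and detection\<close>

definition cinner :: "complex ^ 'x::finite \<Rightarrow> complex ^ 'x \<Rightarrow> complex" where
  "cinner \<phi> \<psi> = (\<Sum>x\<in>UNIV. cnj (\<phi> $ x) * \<psi> $ x)"

definition dagger :: "complex ^ 'x::finite ^ 'x \<Rightarrow> complex ^ 'x ^ 'x" where
  "dagger A = (\<chi> x y. cnj (A $ y $ x))"

text \<open>The operator \<open>|\<psi>\<rangle>\<langle>\<psi>|\<close>.\<close>

definition pure_state :: "complex ^ 'x::finite \<Rightarrow> complex ^ 'x ^ 'x" where
  "pure_state \<psi> = (\<chi> x y. \<psi> $ x * cnj (\<psi> $ y))"

text \<open>A quantum operation (completely positive trace-preserving map) is given by a list of Kraus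
  operators.\<close>

definition is_kraus :: "(complex ^ 'x::finite ^ 'x) list \<Rightarrow> bool" where
  "is_kraus Rs \<longleftrightarrow> (\<Sum>R\<leftarrow>Rs. dagger R ** R) = mat 1"

definition kraus_map :: "(complex ^ 'x::finite ^ 'x) list \<Rightarrow> complex ^ 'x ^ 'x \<Rightarrow> complex ^ 'x ^ 'x" where
  "kraus_map Rs \<rho> = (\<Sum>R\<leftarrow>Rs. R ** \<rho> ** dagger R)"

text \<open>One recovery operation has to undo every error in the set. All errors considered are
  unitary, so no renormalisation is needed.\<close>

definition corrects :: "(complex ^ 'x::finite) set \<Rightarrow> (complex ^ 'x ^ 'x) set \<Rightarrow> bool" where
  "corrects Q \<E> \<longleftrightarrow> (\<exists>Rs. is_kraus Rs \<and>
     (\<forall>E\<in>\<E>. \<forall>\<psi>\<in>Q. kraus_map Rs (E ** pure_state \<psi> ** dagger E) = pure_state \<psi>))"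

text \<open>An error \<open>E\<close> is detected if \<open>P E P = c P\<close>, where \<open>P\<close> is the orthogonal projection onto \<open>Q\<close>.\<close>

definition detects :: "(complex ^ 'x::finite) set \<Rightarrow> (complex ^ 'x ^ 'x) set \<Rightarrow> bool" where
  "detects Q \<E> \<longleftrightarrow>
     (\<forall>E\<in>\<E>. \<exists>c. \<forall>\<phi>\<in>Q. \<forall>\<psi>\<in>Q. cinner \<phi> (E *v \<psi>) = c * cinner \<phi> \<psi>)"

text \<open>The code \<open>Q\<close> has parameters \<open>[[n, k, d\<^sub>z/d\<^sub>x]]\<^sub>q\<close> with \<open>q = CARD('a)\<close> and \<open>n = CARD('n)\<close>.
  The numbers \<open>d\<^sub>z\<close> and \<open>d\<^sub>x\<close> are not required to be maximal.\<close>

definition asymmetric_quantum_code ::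
    "nat \<Rightarrow> nat \<Rightarrow> nat \<Rightarrow> (complex ^ ('a::finite_field ^ 'n::finite)) set \<Rightarrow> bool" where
  "asymmetric_quantum_code k dz dx Q \<longleftrightarrow>
     vec.subspace Q \<and> vec.dim Q = CARD('a) ^ k \<and>
     corrects Q (errors ((dx - 1) div 2) ((dz - 1) div 2)) \<and>
     detects Q (errors (dx - 1) (dz - 1))"


section \<open>The dimensions \<open>k\<^sub>i\<close>\<close>

definition toric_dim :: "nat \<Rightarrow> nat \<Rightarrow> nat \<Rightarrow> nat" where
  "toric_dim q a b = ((q - 1) * (a + b + 1) + gcd (a - b) (q - 2) + 1) div 2"

text \<open>The division is exact.\<close>

lemma toric_dim_exact:
  assumes "2 \<le> q" "b \<le> a"
  shows "2 * toric_dim q a b = (q - 1) * (a + b + 1) + gcd (a - b) (q - 2) + 1"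
proof -
  have "even ((q - 1) * (a + b + 1) + gcd (a - b) (q - 2) + 1)"
  proof (cases "even q")
    case True
    then have "even (gcd (a - b) (q - 2)) \<longleftrightarrow> even (a - b)"
      using assms by simp
    then show ?thesis
      using True assms by auto
  next
    case False
    then have "odd (gcd (a - b) (q - 2))"
      using assms by simp
    then show ?thesis
      using False by simp
  qed
  then show ?thesis
    by (simp add: toric_dim_def)
qed

end

theory Submission
  imports Defs "HOL-Number_Theory.Cong"
begin

text \<open>
  Since \<open>gcd (a - b) (q - 2) \<le> q - 2\<close> and \<open>b \<le> a\<close>, the dimension \<open>k\<^sub>i\<close> is at most
  \<open>(q - 1) (a\<^sub>i + 1)\<close>, its value at \<open>b\<^sub>i = a\<^sub>i\<close>. There the toric code is a direct sum of \<open>q - 1\<close>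
  Reed-Solomon codes, one on each row of the grid \<open>(F\<^sub>q - {0}) \<times> (F\<^sub>q - {0})\<close>. On every row take the nested codes
  of polynomials of degree less than \<open>l = q - 2 - a\<^sub>1\<close> and less than \<open>m = a\<^sub>2 + 1\<close>; this gives
  \<open>D \<subseteq> C\<close>, where \<open>C\<close> has minimum distance at least \<open>q - m\<close> and no non-zero word of weight at most
  \<open>l\<close> is orthogonal to \<open>D\<close>. The uniform superpositions of the cosets of \<open>D\<close> in \<open>C\<close> span a CSS code,
  and a subspace of a code inherits its error control, so \<open>q\<^sup>k\<close> of the cosets suffice.
  Inside these distances every non-trivial error maps the code to an orthogonal space, so
  the images of the code under the correctable errors are pairwise orthogonal and the recovery measures
  which of them contains the state.
\<close>


section \<open>The trace and the canonical additive character\<close>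

definition add_closed :: "'a::monoid_add set \<Rightarrow> bool" where
  "add_closed H \<longleftrightarrow> 0 \<in> H \<and> (\<forall>x\<in>H. \<forall>y\<in>H. x + y \<in> H)"

lemma add_closed_of_nat_mult:
  fixes H :: "'a::semiring_1 set"
  assumes "add_closed H" "x \<in> H"
  shows "of_nat n * x \<in> H"
  using assms by (induction n) (auto simp: add_closed_def algebra_simps)

lemma of_nat_mod_CHAR: "of_nat (n mod CHAR('a)) = (of_nat n :: 'a::semiring_1_cancel)"
  by (simp add: of_nat_eq_iff_cong_CHAR)

text \<open>If two translates of \<open>H\<close> by multiples of \<open>x\<close> met,
  \<open>(c' - c) * x\<close> would lie in \<open>H\<close> with \<open>c' - c\<close> invertible
  modulo the characteristic, forcing \<open>x\<close> into \<open>H\<close>.\<close>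

lemma add_closed_extend:
  fixes H :: "'a::finite_field set"
  assumes H: "add_closed H" and x: "x \<notin> H"
  defines "H' \<equiv> (\<lambda>(h, c). h + of_nat c * x) ` (H \<times> {..<CHAR('a)})"
  shows "add_closed H'" "card H' = card H * CHAR('a)"
proof -
  have "h + of_nat c * x + (h' + of_nat c' * x) \<in> H'" if "h \<in> H" "h' \<in> H" for h h' c c'
  proof -
    have "h + of_nat c * x + (h' + of_nat c' * x) = (h + h') + of_nat ((c + c') mod CHAR('a)) * x"
      by (simp add: of_nat_mod_CHAR algebra_simps)
    moreover have "(h + h', (c + c') mod CHAR('a)) \<in> H \<times> {..<CHAR('a)}"
      using H that by (auto simp: add_closed_def)
    ultimately show ?thesis
      unfolding H'_def by force
  qed
  moreover have "0 \<in> H'"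
    unfolding H'_def using H by (auto simp: add_closed_def intro!: image_eqI[of _ _ "(0, 0)"])
  ultimately show "add_closed H'"
    unfolding add_closed_def by (auto simp: H'_def)
  \<comment> \<open>Multiplying by \<open>CHAR('a) - 1\<close> is negation, so additive closure
    alone provides inverses.\<close>
  have neg: "- h \<in> H" if "h \<in> H" for h
  proof -
    have "of_nat (CHAR('a) - 1) * h = - h"
      using CHAR_pos[where ?'a = 'a] by (subst of_nat_diff) (auto simp: Suc_le_eq simp del: CHAR_pos)
    then show ?thesis
      using add_closed_of_nat_mult[OF H that] by metis
  qed
  have less: "\<not> c < c'" if "h \<in> H" "h' \<in> H" "h + of_nat c * x = h' + of_nat c' * x" "c' < CHAR('a)"
    for h h' c c'
  proof
    assume "c < c'"
    then have "coprime (c' - c) CHAR('a)"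
      using that(4) by (intro prime_imp_coprime[THEN coprime_commute[THEN iffD1]])
        (auto dest: dvd_imp_le)
    then obtain m where "[(c' - c) * m = 1] (mod CHAR('a))"
      using cong_solve_coprime_nat by auto
    then have "of_nat m * of_nat (c' - c) = (1 :: 'a)"
      by (metis mult.commute of_nat_1 of_nat_eq_iff_cong_CHAR of_nat_mult)
    then have "of_nat m * (of_nat (c' - c) * x) = x"
      by (simp flip: mult.assoc)
    moreover have "of_nat (c' - c) * x = h + - h'"
      using that(3) \<open>c < c'\<close> by (simp add: of_nat_diff algebra_simps)
    moreover have "h + - h' \<in> H"
      using neg that(1,2) H by (auto simp: add_closed_def simp del: add_uminus_conv_diff)
    ultimately show False
      using x add_closed_of_nat_mult[OF H] by metis
  qed
  have "h = h' \<and> c = c'"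
    if "h \<in> H" "h' \<in> H" "c < CHAR('a)" "c' < CHAR('a)" "h + of_nat c * x = h' + of_nat c' * x"
    for h h' c c'
  proof -
    have "c = c'"
      using less[of h h' c c'] less[of h' h c' c] that by (metis linorder_neqE_nat)
    then show ?thesis
      using that by simp
  qed
  then have "inj_on (\<lambda>(h, c). h + of_nat c * x) (H \<times> {..<CHAR('a)})"
    by (force simp: inj_on_def)
  then show "card H' = card H * CHAR('a)"
    by (simp add: H'_def card_image card_cartesian_product)
qed

text \<open>In characteristic \<open>p > 0\<close> a set closed under addition is a subgroup, and adjoining an element
  multiplies its size by \<open>p\<close>; start from \<open>{0}\<close> and repeat.\<close>

lemma CARD_eq_CHAR_power: "\<exists>m. CARD('a::finite_field) = CHAR('a) ^ m"
proof -
  have "\<exists>m. CARD('a) = CHAR('a) ^ m" if "add_closed H" "card H = CHAR('a) ^ j" for H :: "'a set" and j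
    using that
  proof (induction "card (- H)" arbitrary: H j rule: less_induct)
    case less
    show ?case
    proof (cases "H = UNIV")
      case False
      then obtain x where x: "x \<notin> H"
        by auto
      let ?H' = "(\<lambda>(h, c). h + of_nat c * x) ` (H \<times> {..<CHAR('a)})"
      have "card H > 0"
        using less.prems by (simp add: prime_gt_0_nat)
      then have "card H < card H * CHAR('a)"
        using prime_gt_1_nat[OF CHAR_prime[where ?'a = 'a]] by simp
      then have "card (- ?H') < card (- H)"
        using add_closed_extend(2)[OF less.prems(1) x] card_mono[of UNIV ?H']
        unfolding Compl_eq_Diff_UNIV by (subst (1 2) card_Diff_subset; simp; linarith)
      then show ?thesis
        using less.hyps[of ?H' "Suc j"] add_closed_extend[OF less.prems(1) x] less.prems by simp
    qed (use less in auto)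
  qed
  from this[of "{0}" 0] show ?thesis
    by (auto simp: add_closed_def)
qed

lemma CHAR_gt_1: "CHAR('a::finite_field) > 1"
  by (rule prime_gt_1_nat) simp

lemma CARD_eq_CHAR_power_prime_degree:
  "CARD('a::finite_field) = CHAR('a) ^ prime_degree TYPE('a)"
  unfolding prime_degree_def
proof (rule theI')
  show "\<exists>!m. CARD('a) = CHAR('a) ^ m"
    using CARD_eq_CHAR_power[where ?'a = 'a] CHAR_gt_1[where ?'a = 'a]
    by (metis power_inject_exp)
qed

lemma prime_degree_pos: "prime_degree TYPE('a::finite_field) > 0"
proof (rule ccontr)
  assume "\<not> ?thesis"
  then have "CARD('a) = 1"
    using CARD_eq_CHAR_power_prime_degree[where ?'a = 'a] by simp
  then obtain z where "(UNIV :: 'a set) = {z}"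
    using card_1_singletonE by blast
  then have "(0::'a) = 1"
    by (metis UNIV_I singletonD)
  then show False by simp
qed

section \<open>The trace and the prime field\<close>

lemma field_tr_add: "field_tr (x + y) = field_tr x + field_tr y"
  by (simp add: field_tr_def freshmans_dream' sum.distrib)

text \<open>Frobenius shifts the summands cyclically: the last one becomes
  \<open>x ^ CARD('a)\<close>, which is \<open>x\<close> again.\<close>

lemma field_tr_power_CHAR: "field_tr x ^ CHAR('a) = field_tr (x :: 'a::finite_field)"
proof -
  let ?m = "prime_degree TYPE('a)" and ?p = "CHAR('a)"
  obtain m where m: "?m = Suc m"
    using prime_degree_pos by (metis gr0_implies_Suc)
  have "field_tr x ^ ?p = (\<Sum>i<?m. x ^ (?p ^ Suc i))"
    by (simp add: field_tr_def freshmans_dream_sum mult.commute flip: power_mult)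
  also have "\<dots> = (\<Sum>i<m. x ^ (?p ^ Suc i)) + x ^ CARD('a)"
    by (simp add: m CARD_eq_CHAR_power_prime_degree)
  also have "\<dots> = field_tr x"
    unfolding field_tr_def m finite_field_power_card_eq_same sum.lessThan_Suc_shift by simp
  finally show ?thesis .
qed

text \<open>A non-zero polynomial of degree below \<open>m\<close> has few roots; this later yields
  the distance of the Reed-Solomon codes.\<close>

lemma card_Collect_poly_eq_0_le:
  fixes c :: "nat \<Rightarrow> 'a::idom"
  assumes "j < m" "c j \<noteq> 0"
  shows "card {y. (\<Sum>i<m. c i * y ^ i) = 0} < m"
proof -
  define P where "P = (\<Sum>i<m. monom (c i) i)"
  have "coeff P j = c j"
    using assms(1) by (simp add: P_def coeff_sum)
  then have "P \<noteq> 0"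
    using assms(2) by auto
  moreover have "degree P < m"
    unfolding P_def using assms(1)
    by (intro degree_sum_less) (auto intro: le_less_trans[OF degree_monom_le])
  moreover have "poly P y = (\<Sum>i<m. c i * y ^ i)" for y
    by (simp add: P_def poly_sum poly_monom)
  ultimately show ?thesis
    using card_poly_roots_bound[of P] by simp
qed

text \<open>The polynomial \<open>X^p - X\<close> has at most \<open>p\<close> roots, and the
  \<open>p\<close> distinct residues are roots by Fermat, so there are no others.\<close>

lemma prime_field_of_nat:
  fixes y :: "'a::finite_field"
  assumes "y ^ CHAR('a) = y"
  shows "\<exists>!c. c < CHAR('a) \<and> of_nat c = y"
proof -
  let ?p = "CHAR('a)"
  define P :: "'a poly" where "P = monom 1 ?p - monom 1 1"
  have "coeff P ?p = 1"
    using CHAR_gt_1[where ?'a = 'a] by (simp add: P_def)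
  then have "P \<noteq> 0" by auto
  have "degree P \<le> ?p"
    unfolding P_def using CHAR_gt_1[where ?'a = 'a] by (intro degree_diff_le) (auto simp: degree_monom_eq)
  have roots: "{x. poly P x = 0} = {x. x ^ ?p = x}"
    by (auto simp: P_def poly_monom)
  have inj: "inj_on (of_nat :: nat \<Rightarrow> 'a) {..<?p}"
    by (auto simp: inj_on_def of_nat_eq_iff_cong_CHAR cong_def)
  have fermat: "of_nat c ^ ?p = (of_nat c :: 'a)" for c
  proof (induction c)
    case 0
    then show ?case by (simp add: power_0_left)
  next
    case (Suc c)
    then show ?case
      using freshmans_dream[where ?'a = 'a, of ?p 1 "of_nat c"] by simp
  qed
  have "of_nat ` {..<?p} = {x. poly P x = 0}"
  proof (rule card_seteq)
    show "of_nat ` {..<?p} \<subseteq> {x. poly P x = 0}"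
      using fermat by (auto simp: roots)
    show "card {x. poly P x = 0} \<le> card ((of_nat :: nat \<Rightarrow> 'a) ` {..<?p})"
      using card_poly_roots_bound[OF \<open>P \<noteq> 0\<close>] \<open>degree P \<le> ?p\<close> inj by (simp add: card_image)
  qed simp
  then have "y \<in> of_nat ` {..<?p}"
    using assms roots by simp
  then show ?thesis
    using inj by (auto simp: inj_on_def)
qed

lemma of_nat_tr: "of_nat (tr x) = field_tr (x :: 'a::finite_field)"
  unfolding tr_def
  using theI'[OF prime_field_of_nat[OF field_tr_power_CHAR]] by blast

text \<open>Seen as a polynomial in \<open>x\<close>, the trace is non-zero of degree below
  \<open>CARD('a)\<close>, too small for it to vanish on the whole field.\<close>

lemma field_tr_nonzero: "\<exists>x :: 'a::finite_field. field_tr x \<noteq> 0"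
proof (rule ccontr)
  let ?m = "prime_degree TYPE('a)" and ?p = "CHAR('a)"
  assume "\<not> ?thesis"
  then have tr0: "field_tr x = 0" for x :: 'a
    by blast
  define P :: "'a poly" where "P = (\<Sum>i<?m. monom 1 (?p ^ i))"
  have inj: "?p ^ i = ?p ^ j \<longleftrightarrow> i = j" for i j
    using CHAR_gt_1[where ?'a = 'a] by (simp add: power_inject_exp)
  have "coeff P (?p ^ 0) = 1"
    unfolding P_def coeff_sum coeff_monom inj using prime_degree_pos[where ?'a = 'a] by simp
  then have "P \<noteq> 0" by auto
  moreover have "degree P < CARD('a)"
    unfolding P_def CARD_eq_CHAR_power_prime_degree
    using CHAR_gt_1[where ?'a = 'a]
    by (intro degree_sum_less) (auto simp: degree_monom_eq)
  moreover have "poly P x = 0" for x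
    using tr0[of x] by (simp add: P_def poly_sum poly_monom field_tr_def)
  ultimately show False
    using card_poly_roots_bound[of P] by simp
qed

section \<open>The additive character and its non-triviality\<close>

definition addchar :: "'a::finite_field \<Rightarrow> complex" where
  "addchar x = \<omega> TYPE('a) ^ tr x"

lemma \<omega>_power_eq_1_iff: "\<omega> TYPE('a::finite_field) ^ c = 1 \<longleftrightarrow> CHAR('a) dvd c"
proof -
  have "\<omega> TYPE('a) ^ c = exp (2 * of_real pi * \<i> * of_nat c / of_nat CHAR('a))"
    by (simp add: \<omega>_def mult_ac flip: exp_of_nat_mult)
  then show ?thesis
    using CHAR_gt_1[where ?'a = 'a] complex_root_unity_eq_1[of "CHAR('a)" c] by simp
qed

lemma norm_\<omega> [simp]: "norm (\<omega> TYPE('a::finite_field)) = 1"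
  by (simp add: \<omega>_def)

text \<open>\<open>tr\<close> is additive only modulo \<open>CHAR('a)\<close>; since \<omega> has
  that order, exponents may be compared inside the field.\<close>

lemma \<omega>_power_cong:
  assumes "(of_nat c :: 'a::finite_field) = of_nat d"
  shows "\<omega> TYPE('a) ^ c = \<omega> TYPE('a) ^ d"
proof -
  have mod: "\<omega> TYPE('a) ^ c = \<omega> TYPE('a) ^ (c mod CHAR('a))" for c
  proof -
    have "\<omega> TYPE('a) ^ c = \<omega> TYPE('a) ^ (CHAR('a) * (c div CHAR('a)) + c mod CHAR('a))"
      by simp
    also have "\<dots> = \<omega> TYPE('a) ^ (c mod CHAR('a))"
      unfolding power_add using \<omega>_power_eq_1_iff[where ?'a = 'a] by simp
    finally show ?thesis .
  qed
  have "c mod CHAR('a) = d mod CHAR('a)"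
    using assms by (simp add: of_nat_eq_iff_cong_CHAR cong_def)
  then show ?thesis
    using mod[of c] mod[of d] by simp
qed

lemma addchar_add: "addchar (x + y) = addchar x * addchar (y :: 'a::finite_field)"
proof -
  have "of_nat (tr (x + y)) = (of_nat (tr x + tr y) :: 'a)"
    by (simp add: of_nat_tr field_tr_add)
  then show ?thesis
    unfolding addchar_def power_add[symmetric] by (rule \<omega>_power_cong)
qed

lemma norm_addchar [simp]: "norm (addchar x) = 1"
  by (simp add: addchar_def norm_power)

lemma addchar_0 [simp]: "addchar (0 :: 'a::finite_field) = 1"
proof -
  have "addchar (0 :: 'a) * addchar (0 :: 'a) = addchar (0 :: 'a) * 1"
    by (simp flip: addchar_add)
  moreover have "addchar (0 :: 'a) \<noteq> 0"
    using norm_addchar[of "0 :: 'a"] by (metis norm_zero zero_neq_one)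
  ultimately show ?thesis
    by (simp only: mult_cancel_left) simp
qed

lemma addchar_nontrivial: "\<exists>x :: 'a::finite_field. addchar x \<noteq> 1"
proof -
  obtain x :: 'a where "field_tr x \<noteq> 0"
    using field_tr_nonzero by blast
  then have "\<not> CHAR('a) dvd tr x"
    by (metis of_nat_tr of_nat_eq_0_iff_char_dvd)
  then show ?thesis
    by (auto simp: addchar_def \<omega>_power_eq_1_iff)
qed


section \<open>Codes spanned by orthonormal families\<close>

text \<open>The operator \<open>|phi><psi|\<close>. Sums of these with different left and right
  vectors serve as recovery operators.\<close>

definition outer :: "complex ^ 'x::finite \<Rightarrow> complex ^ 'x \<Rightarrow> complex ^ 'x ^ 'x" where
  "outer \<phi> \<psi> = (\<chi> x y. \<phi> $ x * cnj (\<psi> $ y))"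

lemma pure_state_eq_outer: "pure_state \<psi> = outer \<psi> \<psi>"
  by (simp add: pure_state_def outer_def)

lemma matrix_mult_outer: "A ** outer \<phi> \<psi> = outer (A *v \<phi>) \<psi>"
  by (simp add: vec_eq_iff outer_def matrix_matrix_mult_def matrix_vector_mult_def
      sum_distrib_right mult.assoc)

lemma outer_mult_dagger: "outer \<phi> \<psi> ** dagger A = outer \<phi> (A *v \<psi>)"
  by (simp add: vec_eq_iff outer_def dagger_def matrix_matrix_mult_def matrix_vector_mult_def
      sum_distrib_left mult_ac)

lemma outer_mult_vec: "outer \<phi> \<psi> *v \<xi> = cinner \<psi> \<xi> *s \<phi>"
  by (simp add: vec_eq_iff outer_def cinner_def matrix_vector_mult_def
      sum_distrib_left mult_ac)

lemma dagger_outer: "dagger (outer \<phi> \<psi>) = outer \<psi> \<phi>"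
  by (simp add: vec_eq_iff outer_def dagger_def)

lemma dagger_sum: "dagger (\<Sum>i\<in>I. A i) = (\<Sum>i\<in>I. dagger (A i))"
  by (simp add: vec_eq_iff dagger_def)

lemma dagger_diff: "dagger (A - B) = dagger A - dagger B"
  by (simp add: vec_eq_iff dagger_def)

lemma dagger_mat_1: "dagger (mat 1) = mat 1"
  by (auto simp: vec_eq_iff dagger_def mat_def)

lemma matrix_mult_sum_right: "(A :: complex ^ 'x::finite ^ 'x) ** (\<Sum>i\<in>I. B i) = (\<Sum>i\<in>I. A ** B i)"
  by (induction I rule: infinite_finite_induct) (simp_all add: matrix_add_ldistrib)

lemma sum_matrix_vector_mult: "(\<Sum>i\<in>I. A i :: complex ^ 'x::finite ^ 'x) *v \<psi> = (\<Sum>i\<in>I. A i *v \<psi>)"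
  by (induction I rule: infinite_finite_induct) (simp_all add: matrix_vector_mult_add_rdistrib)

lemma matrix_mult_diff_right: "(A :: complex ^ 'x::finite ^ 'x) ** (B - C) = A ** B - A ** C"
  by (simp add: vec_eq_iff matrix_matrix_mult_def right_diff_distrib sum_subtractf)

lemma matrix_mult_diff_left: "(B - C :: complex ^ 'x::finite ^ 'x) ** A = B ** A - C ** A"
  by (simp add: vec_eq_iff matrix_matrix_mult_def left_diff_distrib sum_subtractf)

lemma pure_state_scale:
  assumes "norm c = 1"
  shows "pure_state (c *s \<psi>) = pure_state \<psi>"
proof -
  have "c * cnj c = 1"
    using assms by (simp add: complex_norm_square[symmetric])
  then show ?thesis
    by (simp add: vec_eq_iff pure_state_def algebra_simps)
qed

lemma pure_state_0: "pure_state 0 = 0"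
  by (simp add: vec_eq_iff pure_state_def)

lemma cinner_add_left: "cinner (\<phi> + \<phi>') \<psi> = cinner \<phi> \<psi> + cinner \<phi>' \<psi>"
  by (simp add: cinner_def algebra_simps sum.distrib)

lemma cinner_add_right: "cinner \<phi> (\<psi> + \<psi>') = cinner \<phi> \<psi> + cinner \<phi> \<psi>'"
  by (simp add: cinner_def algebra_simps sum.distrib)

lemma cinner_scale_left: "cinner (c *s \<phi>) \<psi> = cnj c * cinner \<phi> \<psi>"
  by (simp add: cinner_def sum_distrib_left mult_ac)

lemma cinner_scale_right: "cinner \<phi> (c *s \<psi>) = c * cinner \<phi> \<psi>"
  by (simp add: cinner_def sum_distrib_left mult_ac)

lemma cinner_0_left [simp]: "cinner 0 \<psi> = 0"
  by (simp add: cinner_def)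

lemma cinner_0_right [simp]: "cinner \<phi> 0 = 0"
  by (simp add: cinner_def)

lemma cinner_sum_right: "cinner \<phi> (\<Sum>i\<in>I. f i) = (\<Sum>i\<in>I. cinner \<phi> (f i))"
  by (induction I rule: infinite_finite_induct) (simp_all add: cinner_add_right)

lemma matrix_vector_mult_scale: "(A :: complex ^ 'x::finite ^ 'x) *v (c *s \<psi>) = c *s (A *v \<psi>)"
  by (simp add: vec_eq_iff matrix_vector_mult_def sum_distrib_left mult_ac)

lemma mult_eq_scale_on_span:
  fixes M :: "complex ^ 'x::finite ^ 'x"
  assumes "\<psi> \<in> vec.span B" "\<And>b. b \<in> B \<Longrightarrow> M *v b = k *s b"
  shows "M *v \<psi> = k *s \<psi>"
  using assms(1)
proof (induction rule: vec.span_induct)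
  case base
  show ?case
    by (auto simp: vec.subspace_def matrix_vector_right_distrib matrix_vector_mult_scale
        vec.scale_right_distrib mult.commute)
qed (use assms(2) in simp)

section \<open>Dimension, detection and correction for orthonormally spanned codes\<close>

locale orthonormal_family =
  fixes e :: "'t \<Rightarrow> complex ^ 'x::finite" and T :: "'t set"
  assumes finite_index: "finite T"
    and orthonormal: "\<And>s t. s \<in> T \<Longrightarrow> t \<in> T \<Longrightarrow> cinner (e s) (e t) = (if s = t then 1 else 0)"
begin

lemma dim_span: "vec.dim (vec.span (e ` T)) = card T"
proof -
  have inj: "inj_on e T"
  proof (rule inj_onI)
    fix s t
    assume "s \<in> T" "t \<in> T" "e s = e t"
    then show "s = t"
      using orthonormal[of s t] orthonormal[of s s] by (auto split: if_splits)
  qed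
  have "vec.independent (e ` T)"
  proof (rule vec.independent_if_scalars_zero)
    fix f x
    assume sum: "(\<Sum>x\<in>e ` T. f x *s x) = 0" and "x \<in> e ` T"
    then obtain s where s: "s \<in> T" "x = e s"
      by blast
    have "0 = cinner (e s) (\<Sum>t\<in>T. f (e t) *s e t)"
      using sum inj by (simp add: sum.reindex)
    also have "\<dots> = (\<Sum>t\<in>T. if s = t then f (e t) else 0)"
      using s orthonormal
      by (auto simp: cinner_sum_right cinner_scale_right intro!: sum.cong)
    also have "\<dots> = f x"
      using s finite_index by simp
    finally show "f x = 0"
      by simp
  qed (use finite_index in simp)
  then show ?thesis
    using inj by (metis vec.dim_span_eq_card_independent card_image)
qed

text \<open>Both sides are linear in the right vector and conjugate-linear in the left one, and
  \<open>c\<close> is uniform in \<open>s\<close> and \<open>t\<close>, so the identity extends from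
  basis vectors one argument at a time.\<close>

lemma detects_span:
  assumes "\<And>E. E \<in> \<E> \<Longrightarrow> \<exists>c. \<forall>s\<in>T. \<forall>t\<in>T. cinner (e s) (E *v e t) = c * cinner (e s) (e t)"
  shows "detects (vec.span (e ` T)) \<E>"
  unfolding detects_def
proof
  fix E
  assume "E \<in> \<E>"
  then obtain c where c: "\<And>s t. s \<in> T \<Longrightarrow> t \<in> T \<Longrightarrow> cinner (e s) (E *v e t) = c * cinner (e s) (e t)"
    using assms by blast
  have 1: "cinner (e s) (E *v \<psi>) = c * cinner (e s) \<psi>" if "s \<in> T" "\<psi> \<in> vec.span (e ` T)" for s \<psi>
    using that(2)
  proof (induction rule: vec.span_induct)
    case base
    show ?case
      by (auto simp: vec.subspace_def matrix_vector_right_distrib matrix_vector_mult_scale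
          cinner_add_right cinner_scale_right algebra_simps)
  qed (use c that(1) in auto)
  have "cinner \<phi> (E *v \<psi>) = c * cinner \<phi> \<psi>"
    if "\<phi> \<in> vec.span (e ` T)" "\<psi> \<in> vec.span (e ` T)" for \<phi> \<psi>
    using that(1)
  proof (induction rule: vec.span_induct)
    case base
    show ?case
      by (auto simp: vec.subspace_def cinner_add_left cinner_scale_left algebra_simps)
  qed (use 1 that(2) in auto)
  then show "\<exists>c. \<forall>\<phi>\<in>vec.span (e ` T). \<forall>\<psi>\<in>vec.span (e ` T). cinner \<phi> (E *v \<psi>) = c * cinner \<phi> \<psi>"
    by blast
qed

text \<open>Each error acts, up to a phase, as one of the isometries sending \<open>e t\<close> to
  \<open>F i t\<close>, whose images are pairwise orthogonal. Recovery measures the index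
  \<open>i\<close> and inverts the isometry; the phase is invisible on pure states.\<close>

lemma corrects_span:
  fixes F :: "'i \<Rightarrow> 't \<Rightarrow> complex ^ 'x"
  assumes "finite I"
    and F: "\<And>i j s t. i \<in> I \<Longrightarrow> j \<in> I \<Longrightarrow> s \<in> T \<Longrightarrow> t \<in> T \<Longrightarrow>
              cinner (F i s) (F j t) = (if i = j \<and> s = t then 1 else 0)"
    and err: "\<And>E. E \<in> \<E> \<Longrightarrow> \<exists>i\<in>I. \<exists>c. norm c = 1 \<and> (\<forall>t\<in>T. E *v e t = c *s F i t)"
  shows "corrects (vec.span (e ` T)) \<E>"
proof -
  \<comment> \<open>\<open>R i\<close> inverts the isometry with index \<open>i\<close> and
    annihilates the other images. \<open>P\<close> projects onto the sum of all images;
    \<open>R0\<close>, the outcome outside it, completes the Kraus condition.\<close>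
  define R where "R i = (\<Sum>t\<in>T. outer (e t) (F i t))" for i
  define P where "P = (\<Sum>i\<in>I. \<Sum>t\<in>T. outer (F i t) (F i t))"
  define R0 where "R0 = mat 1 - P"
  obtain xs where xs: "set xs = I" "distinct xs"
    using \<open>finite I\<close> finite_distinct_list by blast
  have RF: "R i *v F j t = (if i = j then e t else 0)" if "i \<in> I" "j \<in> I" "t \<in> T" for i j t
  proof -
    have "R i *v F j t = (\<Sum>s\<in>T. if i = j \<and> s = t then e s else 0)"
      unfolding R_def sum_matrix_vector_mult outer_mult_vec using that F by (intro sum.cong) auto
    then show ?thesis
      using that finite_index by (cases "i = j") auto
  qed
  have PF: "P *v F j t = F j t" if "j \<in> I" "t \<in> T" for j t
  proof -
    have "P *v F j t = (\<Sum>i\<in>I. \<Sum>s\<in>T. if i = j \<and> s = t then F j t else 0)"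
      unfolding P_def sum_matrix_vector_mult outer_mult_vec using that F by (intro sum.cong) auto
    also have "\<dots> = (\<Sum>i\<in>I. if i = j then F j t else 0)"
      using that finite_index by (intro sum.cong) auto
    finally show ?thesis
      using that \<open>finite I\<close> by simp
  qed
  have PP: "P ** P = P"
    using PF by (subst (2 3) P_def) (simp add: matrix_mult_sum_right matrix_mult_outer)
  have "dagger P = P"
    by (simp add: P_def dagger_sum dagger_outer)
  then have R0: "dagger R0 ** R0 = mat 1 - P"
    using PP by (simp add: R0_def dagger_diff dagger_mat_1 matrix_mult_diff_left matrix_mult_diff_right)
  have RR: "dagger (R i) ** R i = (\<Sum>t\<in>T. outer (F i t) (F i t))" if "i \<in> I" for i
  proof -
    have "dagger (R i) *v e t = F i t" if "t \<in> T" for t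
    proof -
      have "dagger (R i) *v e t = (\<Sum>s\<in>T. if s = t then F i t else 0)"
        unfolding R_def dagger_sum dagger_outer sum_matrix_vector_mult outer_mult_vec
        using orthonormal that by (intro sum.cong) auto
      then show ?thesis
        using that finite_index by simp
    qed
    then show ?thesis
      by (subst (2) R_def) (simp add: matrix_mult_sum_right matrix_mult_outer)
  qed
  have "is_kraus (R0 # map R xs)"
    using xs RR by (simp add: is_kraus_def sum_list_distinct_conv_sum_set R0 P_def o_def)
  moreover have "kraus_map (R0 # map R xs) (E ** pure_state \<psi> ** dagger E) = pure_state \<psi>"
    if "E \<in> \<E>" "\<psi> \<in> vec.span (e ` T)" for E \<psi>
  proof -
    obtain j c where j: "j \<in> I" "norm c = 1" "\<And>t. t \<in> T \<Longrightarrow> E *v e t = c *s F j t"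
      using err[OF \<open>E \<in> \<E>\<close>] by blast
    \<comment> \<open>Vanishing is written as scaling by 0 so that the span lemma covers it as
      well.\<close>
    have "(R0 ** E) *v \<psi> = 0 *s \<psi>"
    proof (rule mult_eq_scale_on_span[OF that(2)])
      fix b
      assume "b \<in> e ` T"
      then obtain t where t: "t \<in> T" "b = e t"
        by blast
      have "R0 *v F j t = 0"
        using PF[OF j(1) t(1)] by (simp add: R0_def matrix_vector_mult_diff_rdistrib)
      then show "(R0 ** E) *v b = 0 *s b"
        using j(3)[OF t(1)] t(2) matrix_vector_mul_assoc[of R0 E b]
        by (simp add: matrix_vector_mult_scale)
    qed
    moreover have "(R i ** E) *v \<psi> = (if i = j then c else 0) *s \<psi>" if "i \<in> I" for i
    proof (rule mult_eq_scale_on_span[OF \<open>\<psi> \<in> _\<close>])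
      fix b
      assume "b \<in> e ` T"
      then obtain t where t: "t \<in> T" "b = e t"
        by blast
      then show "(R i ** E) *v b = (if i = j then c else 0) *s b"
        using j(3)[OF t(1)] RF[OF that j(1) t(1)] matrix_vector_mul_assoc[of "R i" E b]
        by (cases "i = j") (simp_all add: matrix_vector_mult_scale)
    qed
    moreover have "M ** (E ** pure_state \<psi> ** dagger E) ** dagger M = pure_state ((M ** E) *v \<psi>)" for M
      by (simp add: pure_state_eq_outer matrix_mult_outer outer_mult_dagger flip: matrix_vector_mul_assoc)
    ultimately have "kraus_map (R0 # map R xs) (E ** pure_state \<psi> ** dagger E)
        = (\<Sum>i\<in>I. pure_state ((if i = j then c else 0) *s \<psi>))"
      using xs by (simp add: kraus_map_def sum_list_distinct_conv_sum_set pure_state_0 o_def)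
    also have "\<dots> = (\<Sum>i\<in>I. if i = j then pure_state \<psi> else 0)"
      using j(2) by (intro sum.cong) (auto simp: pure_state_scale pure_state_0)
    also have "\<dots> = pure_state \<psi>"
      using j(1) \<open>finite I\<close> by simp
    finally show ?thesis .
  qed
  ultimately show ?thesis
    unfolding corrects_def by blast
qed

end


section \<open>CSS codes\<close>

definition vchar :: "'a::finite_field ^ 'n::finite \<Rightarrow> 'a ^ 'n \<Rightarrow> complex" where
  "vchar v x = addchar (\<Sum>i\<in>UNIV. v $ i * x $ i)"

lemma addchar_sum: "addchar (\<Sum>i\<in>I. f i) = (\<Prod>i\<in>I. addchar (f i :: 'a::finite_field))"
  by (induction I rule: infinite_finite_induct) (simp_all add: addchar_add)

lemma vchar_add_left: "vchar (v + v') x = vchar v x * vchar v' x"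
  by (simp add: vchar_def addchar_add algebra_simps sum.distrib)

lemma vchar_add_right: "vchar v (x + y) = vchar v x * vchar v y"
  by (simp add: vchar_def addchar_add algebra_simps sum.distrib)

lemma norm_vchar [simp]: "norm (vchar v x) = 1"
  by (simp add: vchar_def)

lemma vchar_0_left [simp]: "vchar 0 x = 1"
  by (simp add: vchar_def)

lemma vchar_mult_cnj [simp]: "vchar v x * cnj (vchar v x) = 1"
  by (simp add: complex_norm_square[symmetric])

lemma vchar_diff_left: "vchar (v - v') x = vchar v x * cnj (vchar v' x)"
proof -
  have "vchar v x = vchar (v - v') x * vchar v' x"
    using vchar_add_left[of "v - v'" v' x] by simp
  then show ?thesis
    by (simp add: mult.assoc)
qed

lemma Xop_apply: "(Xop u *v \<psi>) $ x = \<psi> $ (x - u)"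
proof -
  have "Xop u $ x $ y = (if y = x - u then 1 else 0)" for y
    unfolding mult_axis_nth[symmetric] Xop_axis by (auto simp: axis_def)
  then show ?thesis
    by (simp add: matrix_vector_mult_def if_distrib[of "\<lambda>c. c * _"] cong: if_cong)
qed

lemma Zop_apply: "(Zop v *v \<psi>) $ x = vchar v x * \<psi> $ x"
proof -
  have "Zop v $ x $ y = (if y = x then vchar v x else 0)" for y
    unfolding mult_axis_nth[symmetric] Zop_axis vchar_def addchar_sum
    by (auto simp: axis_def addchar_def)
  then show ?thesis
    by (simp add: matrix_vector_mult_def if_distrib[of "\<lambda>c. c * _"] cong: if_cong)
qed

lemma mat_mult_vec: "(mat c ** A) *v \<psi> = c *s (A *v \<psi> :: complex ^ 'x::finite)"
proof -
  have "mat c *v \<phi> = c *s \<phi>" for \<phi> :: "complex ^ 'x"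
    by (simp add: mat_def matrix_vector_mult_def vec_eq_iff if_distrib[of "\<lambda>c. c * _"] cong: if_cong)
  then show ?thesis
    by (metis matrix_vector_mul_assoc)
qed

lemma wt_diff_le: "wt (u - v :: 'a::ab_group_add ^ 'n::finite) \<le> wt u + wt v"
proof -
  have "wt (u - v) \<le> card ({i. u $ i \<noteq> 0} \<union> {i. v $ i \<noteq> 0})"
    unfolding wt_def by (intro card_mono) auto
  also have "\<dots> \<le> wt u + wt v"
    unfolding wt_def by (rule card_Un_le)
  finally show ?thesis .
qed

lemma wt_0 [simp]: "wt 0 = 0"
  by (simp add: wt_def)

lemma errorsE:
  assumes "E \<in> errors r s"
  obtains c u v where "norm c = 1" "wt u \<le> r" "wt v \<le> s"
    "\<And>\<psi>. E *v \<psi> = c *s (Xop (u :: 'a::finite_field ^ 'n::finite) *v (Zop v *v \<psi>))"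
proof -
  obtain c u d v where E: "E =
      (mat (\<omega> TYPE('a) ^ c) ** Xop (u :: 'a ^ 'n)) ** (mat (\<omega> TYPE('a) ^ d) ** Zop v)"
    and "wt u \<le> r" "wt v \<le> s"
    using assms unfolding errors_def flip_errors_def phase_errors_def by blast
  moreover have "E *v \<psi> = (\<omega> TYPE('a) ^ c * \<omega> TYPE('a) ^ d) *s (Xop u *v (Zop v *v \<psi>))" for \<psi>
    unfolding E
    by (simp only: matrix_vector_mul_assoc[symmetric, of "mat (\<omega> TYPE('a) ^ c) ** Xop u"]
        mat_mult_vec matrix_vector_mult_scale vec.scale_scale mult.commute)
  moreover have "norm (\<omega> TYPE('a) ^ c * \<omega> TYPE('a) ^ d) = 1"
    by (simp add: norm_mult norm_power)
  ultimately show ?thesis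
    using that by blast
qed

text \<open>\<open>T\<close> represents some of the cosets of \<open>D\<close>. With
  \<open>s = t\<close> the flip distance also bounds the words of \<open>D\<close> itself, so
  non-trivial errors below the distances give orthogonality. The phase distance is a dual distance
  of \<open>D\<close>, expressed by characters because \<open>D\<close> is only an additive
  subgroup.\<close>

locale css_code =
  fixes D T :: "('a::finite_field ^ 'n::finite) set" and dx dz :: nat
  assumes zero_in: "0 \<in> D"
    and diff_in: "\<And>x y. x \<in> D \<Longrightarrow> y \<in> D \<Longrightarrow> x - y \<in> D"
    and representatives: "\<And>s t. s \<in> T \<Longrightarrow> t \<in> T \<Longrightarrow> s - t \<in> D \<Longrightarrow> s = t"
    and flip_distance:
      "\<And>s t w. s \<in> T \<Longrightarrow> t \<in> T \<Longrightarrow> w \<in> D \<Longrightarrow> s - t + w \<noteq> 0 \<Longrightarrow> dx \<le> wt (s - t + w)"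
    and phase_distance: "\<And>v. v \<noteq> 0 \<Longrightarrow> wt v < dz \<Longrightarrow> \<exists>w\<in>D. vchar v w \<noteq> 1"
    and dx_pos: "dx > 0" and dz_pos: "dz > 0"
begin

definition coset_state :: "'a ^ 'n \<Rightarrow> complex ^ ('a ^ 'n)" where
  "coset_state t = (\<chi> x. if x - t \<in> D then of_real (1 / sqrt (card D)) else 0)"

lemma minus_in: "x \<in> D \<Longrightarrow> - x \<in> D"
  using diff_in[OF zero_in] by simp

lemma add_in: "x \<in> D \<Longrightarrow> y \<in> D \<Longrightarrow> x + y \<in> D"
  using diff_in[of x "- y"] minus_in by simp

text \<open>Translating the summation index by \<open>w0\<close> multiplies the sum by a factor
  other than 1.\<close>

lemma sum_vchar: "(\<Sum>w\<in>D. vchar v w) = (if v = 0 then of_nat (card D) else 0)" if "wt v < dz"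
proof (cases "v = 0")
  case False
  then obtain w0 where w0: "w0 \<in> D" "vchar v w0 \<noteq> 1"
    using phase_distance \<open>wt v < dz\<close> by blast
  have "(\<Sum>w\<in>D. vchar v w) = (\<Sum>w\<in>D. vchar v (w0 + w))"
    using w0(1) diff_in add_in
    by (intro sum.reindex_bij_witness[of _ "\<lambda>w. w0 + w" "\<lambda>w. w - w0"]) auto
  also have "\<dots> = vchar v w0 * (\<Sum>w\<in>D. vchar v w)"
    by (simp add: vchar_add_right sum_distrib_left)
  finally show ?thesis
    using w0(2) False by simp
qed simp

text \<open>A flip \<open>u\<close> moves the coset of \<open>t\<close> off the coset of
  \<open>s\<close> unless \<open>u = 0\<close> and \<open>s = t\<close>; on a common coset the phase
  error leaves a character sum over \<open>D\<close>.\<close>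

lemma cinner_error:
  assumes "s \<in> T" "t \<in> T" "wt u < dx" "wt v < dz"
  shows "cinner (coset_state s) (Xop u *v (Zop v *v coset_state t))
    = (if u = 0 \<and> v = 0 \<and> s = t then 1 else 0)"
proof (cases "u = 0 \<and> s = t")
  case True
  have "card D > 0"
    using zero_in by (auto simp: card_gt_0_iff)
  define r :: complex where "r = of_real (1 / sqrt (card D))"
  have "r * r = of_real (1 / card D)"
    unfolding r_def of_real_mult[symmetric] by simp
  then have norm: "cnj r * (z * r) = z / of_nat (card D)" for z
    by (simp add: r_def mult.left_commute[of _ z] del: of_real_divide) simp
  have coset_state_nth: "coset_state a $ x = (if x - a \<in> D then r else 0)" for a x
    by (simp add: coset_state_def r_def)
  have "cinner (coset_state s) (Xop u *v (Zop v *v coset_state t))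
      = (\<Sum>x\<in>UNIV. if x - t \<in> D then vchar v x / of_nat (card D) else 0)"
    unfolding cinner_def Xop_apply Zop_apply coset_state_nth using True norm
    by (intro sum.cong) auto
  also have "\<dots> = (\<Sum>x | x - t \<in> D. vchar v x / of_nat (card D))"
    by (simp add: sum.If_cases)
  also have "\<dots> = (\<Sum>w\<in>D. vchar v (t + w) / of_nat (card D))"
    by (intro sum.reindex_bij_witness[of _ "\<lambda>w. t + w" "\<lambda>x. x - t"]) auto
  also have "\<dots> = vchar v t * (\<Sum>w\<in>D. vchar v w) / of_nat (card D)"
    by (simp add: vchar_add_right sum_distrib_left sum_divide_distrib)
  also have "\<dots> = (if v = 0 then 1 else 0)"
    using \<open>card D > 0\<close> sum_vchar[OF assms(4)] by auto
  finally show ?thesis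
    using True by simp
next
  case False
  have "\<not> (x - s \<in> D \<and> x - u - t \<in> D)" for x
  proof
    assume "x - s \<in> D \<and> x - u - t \<in> D"
    then have w: "(x - s) - (x - u - t) \<in> D"
      using diff_in by blast
    moreover have "s - t + ((x - s) - (x - u - t)) = u"
      by simp
    ultimately have "u = 0"
      using flip_distance[OF assms(1,2) w] assms(3) by auto
    then have "t - s \<in> D"
      using w by simp
    then show False
      using representatives[OF assms(2,1)] False \<open>u = 0\<close> by simp
  qed
  then have "cnj (coset_state s $ x) * (Xop u *v (Zop v *v coset_state t)) $ x = 0" for x
    by (auto simp: Xop_apply Zop_apply coset_state_def)
  then have "cinner (coset_state s) (Xop u *v (Zop v *v coset_state t)) = 0"
    unfolding cinner_def by (intro sum.neutral) blast
  then show ?thesis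
    using False by auto
qed

text \<open>The adjoint of one error times another is, up to a phase from commuting Z past X, the
  error of the differences \<open>u' - u\<close> and \<open>v' - v\<close>. This reduces correction
  to \<open>cinner_error\<close>.\<close>

lemma cinner_error_error:
  "cinner (Xop u *v (Zop v *v \<phi>)) (Xop u' *v (Zop v' *v \<psi>))
    = cnj (vchar v (u' - u)) * cinner \<phi> (Xop (u' - u) *v (Zop (v' - v) *v \<psi>))"
proof -
  have split: "cnj (vchar v (u' - u)) * cnj (vchar v (y - (u' - u))) = cnj (vchar v y)" for y
    using vchar_add_right[of v "u' - u" "y - (u' - u)"] by (simp flip: complex_cnj_mult)
  have "cinner (Xop u *v (Zop v *v \<phi>)) (Xop u' *v (Zop v' *v \<psi>))
      = (\<Sum>x\<in>UNIV. cnj (vchar v (x - u) * \<phi> $ (x - u)) * (vchar v' (x - u') * \<psi> $ (x - u')))"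
    by (simp add: cinner_def Xop_apply Zop_apply)
  also have "\<dots> = (\<Sum>y\<in>UNIV. cnj (vchar v y * \<phi> $ y) *
      (vchar v' (y - (u' - u)) * \<psi> $ (y - (u' - u))))"
    by (rule sum.reindex_bij_witness[of _ "\<lambda>y. y + u" "\<lambda>x. x - u"]) (auto simp: algebra_simps)
  also have "\<dots> = (\<Sum>y\<in>UNIV. cnj (vchar v (u' - u)) * (cnj (\<phi> $ y) *
      (vchar (v' - v) (y - (u' - u)) * \<psi> $ (y - (u' - u)))))"
    unfolding complex_cnj_mult vchar_diff_left
    by (intro sum.cong refl, subst split[symmetric]) (simp only: mult_ac)
  also have "\<dots> = cnj (vchar v (u' - u)) * cinner \<phi> (Xop (u' - u) *v (Zop (v' - v) *v \<psi>))"
    by (simp add: cinner_def Xop_apply Zop_apply sum_distrib_left)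
  finally show ?thesis .
qed

lemma Xop_0_Zop_0: "Xop (0 :: 'a ^ 'n) *v (Zop (0 :: 'a ^ 'n) *v \<psi>) = \<psi>"
  by (simp add: vec_eq_iff Xop_apply Zop_apply)

text \<open>Orthonormality is \<open>cinner_error\<close> for the trivial error, whose weight 0 is
  below both positive distances.\<close>

sublocale orthonormal_family coset_state T
proof
  show "cinner (coset_state s) (coset_state t) = (if s = t then 1 else 0)" if "s \<in> T" "t \<in> T" for s t
    using cinner_error[OF that, of 0 0] dx_pos dz_pos by (simp add: Xop_0_Zop_0)
qed simp

lemma asymmetric_quantum_code_span:
  assumes "card T = CARD('a) ^ k"
  shows "asymmetric_quantum_code k dz dx (vec.span (coset_state ` T))"
  unfolding asymmetric_quantum_code_def
proof (intro conjI)
  show "vec.dim (vec.span (coset_state ` T)) = CARD('a) ^ k"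
    using dim_span assms by simp
  show "detects (vec.span (coset_state ` T)) (errors (dx - 1) (dz - 1))"
  proof (rule detects_span)
    fix E
    assume "E \<in> (errors (dx - 1) (dz - 1) :: (complex ^ ('a ^ 'n) ^ ('a ^ 'n)) set)"
    then obtain c u v where E: "wt u \<le> dx - 1" "wt v \<le> dz - 1"
      "\<And>\<psi>. E *v \<psi> = c *s (Xop (u :: 'a ^ 'n) *v (Zop v *v \<psi>))"
      by (elim errorsE) blast
    have lt: "wt u < dx" "wt v < dz"
      using E(1,2) dx_pos dz_pos by auto
    \<comment> \<open>The detection constant is \<open>c\<close> for the trivial error and 0 for
      every other one.\<close>
    have "cinner (coset_state s) (E *v coset_state t)
        = (if u = 0 \<and> v = 0 then c else 0) * cinner (coset_state s) (coset_state t)"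
      if "s \<in> T" "t \<in> T" for s t
      using that by (simp add: E(3) cinner_scale_right cinner_error lt orthonormal)
    then show "\<exists>c. \<forall>s\<in>T. \<forall>t\<in>T. cinner (coset_state s) (E *v coset_state t)
        = c * cinner (coset_state s) (coset_state t)"
      by blast
  qed
  let ?F = "\<lambda>(u, v) t. Xop u *v (Zop v *v coset_state t)"
  let ?I = "{u :: 'a ^ 'n. wt u \<le> (dx - 1) div 2} \<times> {v :: 'a ^ 'n. wt v \<le> (dz - 1) div 2}"
  show "corrects (vec.span (coset_state ` T)) (errors ((dx - 1) div 2) ((dz - 1) div 2))"
  proof (rule corrects_span[where I = ?I and F = ?F])
    fix i j s t
    assume ij: "i \<in> ?I" "j \<in> ?I" and st: "s \<in> T" "t \<in> T"
    obtain u v u' v' where [simp]: "i = (u, v)" "j = (u', v')"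
      by (cases i, cases j)
    \<comment> \<open>Twice \<open>(d - 1) div 2\<close> is at most \<open>d - 1\<close>, so
      differences of correctable errors stay below the distances.\<close>
    have "wt (u' - u) < dx" "wt (v' - v) < dz"
      using ij wt_diff_le[of u' u] wt_diff_le[of v' v] dx_pos dz_pos by auto
    then show "cinner (?F i s) (?F j t) = (if i = j \<and> s = t then 1 else 0)"
      using st by (auto simp: cinner_error_error cinner_error) (simp add: vchar_def)
  next
    fix E
    assume "E \<in> (errors ((dx - 1) div 2) ((dz - 1) div 2) :: (complex ^ ('a ^ 'n) ^ ('a ^ 'n)) set)"
    then obtain c u v where "norm c = 1" "(u, v) \<in> ?I"
      "\<And>\<psi>. E *v \<psi> = c *s (Xop (u :: 'a ^ 'n) *v (Zop v *v \<psi>))"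
      by (elim errorsE) blast
    then show "\<exists>i\<in>?I. \<exists>c. norm c = 1 \<and> (\<forall>t\<in>T. E *v coset_state t = c *s ?F i t)"
      by (intro bexI[of _ "(u, v)"]) auto
  qed simp
qed (rule vec.subspace_span)

end


section \<open>Reed-Solomon codes on the rows of a grid\<close>

text \<open>The two coordinates identify the bare index type with the pairs of non-zero elements:
  \<open>row\<close> picks a Reed-Solomon block, \<open>pos\<close> is the evaluation point in
  it.\<close>

locale grid =
  fixes row pos :: "'n::finite \<Rightarrow> 'a::finite_field"
  assumes bij_grid: "bij_betw (\<lambda>i. (row i, pos i)) UNIV ((- {0}) \<times> (- {0}))"
begin

text \<open>Row by row, polynomial evaluation with exponents from \<open>l\<close> to
  \<open>m - 1\<close>. The words \<open>ev 0 l\<close> form \<open>D\<close>, the words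
  \<open>ev 0 m\<close> form \<open>C\<close>, and \<open>ev l m\<close> supplies coset
  representatives.\<close>

definition ev :: "nat \<Rightarrow> nat \<Rightarrow> ('a \<times> nat \<Rightarrow> 'a) \<Rightarrow> 'a ^ 'n" where
  "ev l m c = (\<chi> i. \<Sum>j=l..<m. c (row i, j) * pos i ^ j)"

lemma row_nonzero: "row i \<noteq> 0"
  using bij_grid by (auto simp: bij_betw_def)

lemma grid_index:
  assumes "r \<noteq> 0" "y \<noteq> 0"
  obtains i where "row i = r" "pos i = y"
proof -
  have "(r, y) \<in> range (\<lambda>i. (row i, pos i))"
    using bij_grid assms by (simp add: bij_betw_def)
  then show ?thesis
    using that by auto
qed

lemma grid_inject: "row i = row j \<Longrightarrow> pos i = pos j \<Longrightarrow> i = j"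
  using bij_grid by (auto simp: bij_betw_def inj_on_def)

lemma ev_cong:
  assumes "\<And>r j. r \<noteq> 0 \<Longrightarrow> l \<le> j \<Longrightarrow> j < m \<Longrightarrow> c (r, j) = c' (r, j)"
  shows "ev l m c = ev l m c'"
  using assms row_nonzero by (simp add: ev_def vec_eq_iff)

text \<open>One row suffices: its polynomial is non-zero of degree below \<open>m\<close> and has
  few roots.\<close>

lemma wt_ev_ge:
  assumes "r \<noteq> 0" "j < m" "c (r, j) \<noteq> 0"
  shows "CARD('a) - m \<le> wt (ev 0 m c)"
proof -
  let ?f = "\<lambda>y. \<Sum>j<m. c (r, j) * y ^ j"
  have "card {y. ?f y = 0} < m"
    using card_Collect_poly_eq_0_le[of j m "\<lambda>j. c (r, j)"] assms by simp
  \<comment> \<open>0 is no evaluation point; excluding it too uses up the slack in the strict root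
    bound.\<close>
  then have "card (insert 0 {y. ?f y = 0}) \<le> m"
    using card_insert_le_m1[of "m" "{y. ?f y = 0}" 0] assms(2) by simp
  then have "CARD('a) - m \<le> card (- insert 0 {y. ?f y = 0})"
    unfolding Compl_eq_Diff_UNIV by (subst card_Diff_subset) auto
  also have "\<dots> \<le> card {i. ev 0 m c $ i \<noteq> 0}"
  proof (rule surj_card_le)
    show "- insert 0 {y. ?f y = 0} \<subseteq> pos ` {i. ev 0 m c $ i \<noteq> 0}"
    proof
      fix y
      assume y: "y \<in> - insert 0 {y. ?f y = 0}"
      then obtain i where i: "row i = r" "pos i = y"
        using grid_index[OF assms(1)] by auto
      then have "ev 0 m c $ i \<noteq> 0"
        using y by (simp add: ev_def atLeast0LessThan)
      then show "y \<in> pos ` {i. ev 0 m c $ i \<noteq> 0}"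
        using i by blast
    qed
  qed simp
  finally show ?thesis
    by (simp add: wt_def)
qed

text \<open>Representatives and words of \<open>D\<close> use disjoint exponents, so a difference of
  representatives shifted by \<open>D\<close> is a word of \<open>C\<close> with visible
  coefficients.\<close>

lemma ev_combine:
  assumes "l \<le> m"
  shows "ev l m c - ev l m c' + ev 0 l g
    = ev 0 m (\<lambda>(r, j). if j < l then g (r, j) else c (r, j) - c' (r, j))"
proof -
  have "(\<Sum>j=l..<m. c (r, j) * y ^ j) - (\<Sum>j=l..<m. c' (r, j) * y ^ j) + (\<Sum>j=0..<l. g (r, j) * y ^ j)
      = (\<Sum>j=0..<m. (if j < l then g (r, j) else c (r, j) - c' (r, j)) * y ^ j)" for r y
    using assms
    by (subst sum.atLeastLessThan_concat[of 0 l m, symmetric])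
      (simp_all add: sum_subtractf left_diff_distrib)
  then show ?thesis
    by (simp add: vec_eq_iff ev_def)
qed

text \<open>Puts representatives with different coefficients into different cosets of
  \<open>D\<close>: the combined word has weight at least \<open>CARD('a) - m\<close>, which is
  positive.\<close>

lemma ev_combine_nonzero:
  assumes "l \<le> m" "r \<noteq> 0" "l \<le> j" "j < m" "m < CARD('a)" "c (r, j) \<noteq> c' (r, j)"
  shows "ev l m c - ev l m c' + ev 0 l g \<noteq> 0"
proof
  assume "ev l m c - ev l m c' + ev 0 l g = 0"
  moreover have "CARD('a) - m \<le> wt (ev l m c - ev l m c' + ev 0 l g)"
    unfolding ev_combine[OF assms(1)] using assms by (intro wt_ev_ge[of r j]) auto
  ultimately show False
    using assms(5) by simp
qed

text \<open>Interpolation: on the row of one support point \<open>i0\<close>, a polynomial of degree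
  below \<open>l\<close> vanishes at all other support points of \<open>v\<close> in that row.
  Extended by zero to the other rows, it pairs with \<open>v\<close> only at
  \<open>i0\<close>.\<close>

lemma exists_vchar_ne_1:
  assumes "v \<noteq> 0" "wt v \<le> l"
  shows "\<exists>w\<in>range (ev 0 l). vchar v w \<noteq> 1"
proof -
  obtain i0 where i0: "v $ i0 \<noteq> 0"
    using assms(1) by (auto simp: vec_eq_iff)
  define S where "S = pos ` {i. row i = row i0 \<and> v $ i \<noteq> 0}"
  define P where "P = (\<Prod>s\<in>S - {pos i0}. [:- s, 1:])"
  have "card S \<le> wt v"
    unfolding S_def wt_def by (rule order_trans[OF card_image_le]) (auto intro: card_mono)
  moreover have "pos i0 \<in> S"
    using i0 by (auto simp: S_def)
  moreover have "degree P = card (S - {pos i0})"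
    unfolding P_def by (subst degree_prod_eq_sum_degree) auto
  moreover have "card (S - {pos i0}) < card S"
    using \<open>pos i0 \<in> S\<close> by (intro card_Diff1_less) (auto simp: S_def)
  ultimately have deg: "degree P < l"
    using assms(2) by linarith
  have P0: "poly P s = 0 \<longleftrightarrow> s \<in> S - {pos i0}" for s
    by (auto simp: P_def poly_prod S_def)
  obtain x :: 'a where x: "addchar x \<noteq> 1"
    using addchar_nontrivial by blast
  \<comment> \<open>\<open>a\<close> normalises the contribution of \<open>i0\<close> to
    \<open>x\<close>, where the character is not 1.\<close>
  define a where "a = x / (v $ i0 * poly P (pos i0))"
  define w where "w = ev 0 l (\<lambda>(r, j). if r = row i0 then a * coeff P j else 0)"
  have P_eq: "poly P y = (\<Sum>j=0..<l. coeff P j * y ^ j)" for y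
  proof -
    have "poly P y = (\<Sum>j\<le>degree P. coeff P j * y ^ j)"
      by (rule poly_altdef)
    also have "\<dots> = (\<Sum>j=0..<l. coeff P j * y ^ j)"
      using deg by (intro sum.mono_neutral_left) (auto simp: coeff_eq_0)
    finally show ?thesis .
  qed
  have w: "w $ i = (if row i = row i0 then a * poly P (pos i) else 0)" for i
    by (simp add: w_def ev_def P_eq sum_distrib_left mult.assoc)
  have "v $ i * w $ i = (if i = i0 then x else 0)" for i
  proof (cases "i = i0")
    case True
    then show ?thesis
      using i0 P0[of "pos i0"] by (simp add: w a_def)
  next
    case False
    have "v $ i = 0 \<or> pos i \<in> S - {pos i0}" if "row i = row i0"
      using that False grid_inject by (auto simp: S_def)
    then show ?thesis
      using False P0 by (auto simp: w)
  qed
  then have "vchar v w = addchar x"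
    by (simp add: vchar_def)
  moreover have "w \<in> range (ev 0 l)"
    by (simp add: w_def)
  ultimately show ?thesis
    using x by metis
qed

lemma exists_asymmetric_quantum_code:
  assumes "l \<le> m" "m < CARD('a)" "k \<le> (CARD('a) - 1) * (m - l)"
  shows "\<exists>Q :: (complex ^ ('a ^ 'n)) set. asymmetric_quantum_code k (Suc l) (CARD('a) - m) Q"
proof -
  define I where "I = (- {0 :: 'a}) \<times> {l..<m}"
  have "card I = (CARD('a) - 1) * (m - l)"
    unfolding I_def Compl_eq_Diff_UNIV by (simp add: card_cartesian_product card_Diff_subset)
  moreover have "finite I"
    by (simp add: I_def)
  ultimately have card_funs: "card (I \<rightarrow>\<^sub>E (UNIV :: 'a set)) = CARD('a) ^ ((CARD('a) - 1) * (m - l))"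
    by (simp add: card_PiE)
  \<comment> \<open>A coset of \<open>D\<close> determines these coefficients. This serves both the
    injectivity of \<open>ev l m\<close> and the condition on \<open>T\<close>.\<close>
  have coset: "c (r, j) = c' (r, j)"
    if "ev l m c - ev l m c' \<in> range (ev 0 l)" "r \<noteq> 0" "l \<le> j" "j < m" for c c' r j
  proof (rule ccontr)
    assume neg: "c (r, j) \<noteq> c' (r, j)"
    obtain g where "ev l m c - ev l m c' = ev 0 l g"
      using \<open>ev l m c - ev l m c' \<in> _\<close> by blast
    then have "ev l m c - ev l m c' + ev 0 l (\<lambda>z. - g z) = 0"
      by (simp add: vec_eq_iff ev_def sum_negf)
    then show False
      using ev_combine_nonzero[where c = c and c' = c', OF assms(1) that(2-4) assms(2) neg] by blast
  qed
  have zero: "0 \<in> range (ev 0 l)"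
    by (intro range_eqI[of _ _ "\<lambda>_. 0"]) (simp add: ev_def vec_eq_iff)
  have "inj_on (ev l m) (I \<rightarrow>\<^sub>E UNIV)"
  proof (rule inj_onI)
    fix c c'
    assume c: "c \<in> I \<rightarrow>\<^sub>E (UNIV :: 'a set)" "c' \<in> I \<rightarrow>\<^sub>E UNIV" "ev l m c = ev l m c'"
    then have "ev l m c - ev l m c' \<in> range (ev 0 l)"
      using zero by simp
    then have "c z = c' z" if "z \<in> I" for z
      using coset[of c c' "fst z" "snd z"] that by (simp add: I_def mem_Times_iff)
    then show "c = c'"
      using c(1,2) by (intro PiE_ext) auto
  qed
  then have "CARD('a) ^ k \<le> card (ev l m ` (I \<rightarrow>\<^sub>E UNIV))"
    using card_funs assms(3) by (simp add: card_image power_increasing)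
  then obtain T where T: "T \<subseteq> ev l m ` (I \<rightarrow>\<^sub>E UNIV)" "card T = CARD('a) ^ k"
    by (rule obtain_subset_with_card_n)
  interpret css_code "range (ev 0 l)" T "CARD('a) - m" "Suc l"
  proof
    fix x y
    assume "x \<in> range (ev 0 l)" "y \<in> range (ev 0 l)"
    then obtain g h where "x = ev 0 l g" "y = ev 0 l h"
      by blast
    then have "x - y = ev 0 l (\<lambda>z. g z - h z)"
      by (simp add: vec_eq_iff ev_def sum_subtractf left_diff_distrib)
    then show "x - y \<in> range (ev 0 l)"
      by blast
  next
    fix s t
    assume st: "s \<in> T" "t \<in> T" "s - t \<in> range (ev 0 l)"
    obtain c c' where [simp]: "s = ev l m c" "t = ev l m c'"
      using st(1,2) T(1) by blast
    show "s = t"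
      using coset[of c c'] st(3) by (auto intro: ev_cong)
  next
    fix s t w
    assume st: "s \<in> T" "t \<in> T" "w \<in> range (ev 0 l)" "s - t + w \<noteq> 0"
    obtain c c' g where "s = ev l m c" "t = ev l m c'" "w = ev 0 l g"
      using st(1-3) T(1) by blast
    then obtain h where h: "s - t + w = ev 0 m h"
      using ev_combine[OF assms(1)] by blast
    then obtain r j where "r \<noteq> 0" "j < m" "h (r, j) \<noteq> 0"
      using st(4) ev_cong[of 0 m h "\<lambda>_. 0"] by (auto simp: ev_def vec_eq_iff)
    then show "CARD('a) - m \<le> wt (s - t + w)"
      unfolding h by (rule wt_ev_ge)
  next
    fix v :: "'a ^ 'n"
    assume "v \<noteq> 0" "wt v < Suc l"
    then show "\<exists>w\<in>range (ev 0 l). vchar v w \<noteq> 1"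
      using exists_vchar_ne_1 by simp
  qed (use zero assms in auto)
  show ?thesis
    using asymmetric_quantum_code_span[OF T(2)] by blast
qed

end

section \<open>Existence of the grid and comparison with the toric dimensions\<close>

lemma exists_grid:
  assumes "CARD('n::finite) = (CARD('a::finite_field) - 1)\<^sup>2"
  shows "\<exists>row pos :: 'n \<Rightarrow> 'a. grid row pos"
proof -
  have "card (- {0 :: 'a}) = CARD('a) - 1"
    unfolding Compl_eq_Diff_UNIV by (simp add: card_Diff_subset)
  then have "CARD('n) = card ((- {0 :: 'a}) \<times> (- {0 :: 'a}))"
    using assms by (simp add: card_cartesian_product power2_eq_square)
  then obtain h where h: "bij_betw h (UNIV :: 'n set) ((- {0 :: 'a}) \<times> (- {0 :: 'a}))"
    using finite_same_card_bij[OF finite finite] by blast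
  have "grid (fst \<circ> h) (snd \<circ> h)"
    by unfold_locales (use h in simp)
  then show ?thesis
    by blast
qed

lemma toric_dim_le:
  assumes "2 \<le> q" "b \<le> a" "a \<le> q - 2"
  shows "toric_dim q a b \<le> (q - 1) * (a + 1)"
proof -
  \<comment> \<open>For \<open>q = 2\<close> the gcd with 0 is \<open>a - b\<close>, which is 0
    since \<open>a \<le> q - 2\<close>; otherwise it divides the positive number
    \<open>q - 2\<close>.\<close>
  have "gcd (a - b) (q - 2) \<le> q - 2"
    using assms by (cases "q = 2") auto
  then have "2 * toric_dim q a b \<le> (q - 1) * (a + b + 1) + (q - 1)"
    unfolding toric_dim_exact[OF assms(1,2)] using assms(1) by linarith
  also have "\<dots> = (q - 1) * (a + b + 2)"
    by (simp add: algebra_simps)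
  also have "\<dots> \<le> (q - 1) * (2 * (a + 1))"
    using assms(2) by (intro mult_le_mono2) simp
  finally show ?thesis
    by simp
qed

theorem theorem5p2:
  fixes q a1 a2 b1 b2 k1 k2 :: nat
  assumes "q = CARD('a::finite_field)"
    and "CARD('n::finite) = (q - 1)\<^sup>2"
    and "b1 \<le> a1" "a1 \<le> q - 2"
    and "b2 \<le> a2" "a2 \<le> q - 2"
    and "k1 = toric_dim q a1 b1"
    and "k2 = toric_dim q a2 b2"
    and "(q - 1)\<^sup>2 \<le> k1 + k2"
  shows "\<exists>dz dx. \<exists>Q :: (complex ^ ('a ^ 'n)) set.
           asymmetric_quantum_code (k1 + k2 - (q - 1)\<^sup>2) dz dx Q \<and>
           dz \<ge> q - 1 - a1 \<and> dx \<ge> q - 1 - a2"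
proof -
  have "card {0, 1 :: 'a} \<le> q"
    unfolding assms(1) by (rule card_mono) auto
  then have q: "2 \<le> q"
    by simp
  \<comment> \<open>Chosen so that \<open>Suc l\<close> and \<open>q - m\<close> are exactly the
    required distances.\<close>
  define l m where "l = q - 2 - a1" and "m = a2 + 1"
  have "k1 + k2 \<le> (q - 1) * (a1 + 1) + (q - 1) * (a2 + 1)"
    using toric_dim_le[OF q] assms by (intro add_mono) auto
  then have sum: "k1 + k2 \<le> (q - 1) * (a1 + a2 + 2)"
    by (subst (asm) distrib_left[symmetric]) simp
  \<comment> \<open>Non-negativity of the dimension, the last assumption, forces
    \<open>l \<le> m\<close> and so makes the codes nested.\<close>
  then have "(q - 1) * (q - 1) \<le> (q - 1) * (a1 + a2 + 2)"
    using assms(9) by (simp only: power2_eq_square)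
  moreover have "0 < q - 1"
    using q by simp
  ultimately have "q - 1 \<le> a1 + a2 + 2"
    by (simp only: mult_le_cancel1)
  then have "l \<le> m" and ml: "m - l = a1 + a2 + 2 - (q - 1)"
    using assms(4) q by (auto simp: l_def m_def)
  \<comment> \<open>The requested dimension is at most the number of free coefficients, so enough
    cosets exist.\<close>
  have "k1 + k2 - (q - 1)\<^sup>2 \<le> (q - 1) * (m - l)"
    unfolding ml diff_mult_distrib2 power2_eq_square using sum by (rule diff_le_mono)
  moreover have "m < q"
    using assms(6) q by (simp add: m_def)
  moreover obtain row pos :: "'n \<Rightarrow> 'a" where "grid row pos"
    using exists_grid assms(1,2) by blast
  ultimately obtain Q :: "(complex ^ ('a ^ 'n)) set"
    where "asymmetric_quantum_code (k1 + k2 - (q - 1)\<^sup>2) (Suc l) (q - m) Q"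
    using grid.exists_asymmetric_quantum_code \<open>l \<le> m\<close> assms(1) by blast
  moreover have "q - 1 - a1 \<le> Suc l" "q - 1 - a2 \<le> q - m"
    by (auto simp: l_def m_def)
  ultimately show ?thesis
    by blast
qed

end
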